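(* Let $\alpha>0$, $\delta\in(0,\alpha)$, let $U_0,U_1,U_2,\dots$ be i.i.d. random variables uniformly distributed on $(0,1)$, and define $X_0=U_0^{1/\alpha}$ and, for $n=1,2,\dots$, $$X_n=\max\{X_{n-1}^{\alpha/(\alpha-\delta)},\,U_n^{1/\delta}\}.$$ Then: (a) $\{X_n\}_{n\ge 0}$ is a stationary Markov process. (b) $X_n$ has a $PFD(\alpha)$ distribution for each $n$. (c) For each $n\ge 1$, the joint distribution function of $(X_{n-1},X_n)$ is $$P(X_{n-1}\le x_0,\,X_n\le x_1)=x_1^{\delta}\min\{x_0^{\alpha},x_1^{\alpha-\delta}\},\qquad 0\le x_0,x_1\le 1.$$
   Context: For $\gamma>0$, $PFD(\gamma)$ (power function distribution) is the distribution on $[0,1]$ with distribution function $F(x)=x^{\gamma}$, $0\le x\le 1$. Stationary means strictly stationary: all finite-dimensional distributions are invariant under shifts of the index. *)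

theory Defs
  imports "HOL-Probability.Probability"
begin

text \<open>The clamp \<^term>\<open>max 0 (min 1 x)\<close> extends \<^term>\<open>x powr \<gamma>\<close> from the unit interval
  to a distribution function on the whole line, with value 0 on the left and 1 on the right.\<close>

definition PFD :: "real \<Rightarrow> real measure" where
  "PFD \<gamma> = interval_measure (\<lambda>x. max 0 (min 1 x) powr \<gamma>)"

lemma
  assumes "\<gamma> > 0"
  shows real_distribution_PFD: "real_distribution (PFD \<gamma>)"
    and cdf_PFD: "cdf (PFD \<gamma>) x = max 0 (min 1 x) powr \<gamma>"
proof -
  let ?F = "\<lambda>x::real. max 0 (min 1 x) powr \<gamma>"
  have mono: "?F x \<le> ?F y" if "x \<le> y" for x y
    using that assms by (intro powr_mono2) auto
  have "continuous_on UNIV ?F"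
    using assms by (intro continuous_on_powr' continuous_intros) auto
  then have cont: "continuous (at_right a) ?F" for a
    by (metis UNIV_I continuous_on_eq_continuous_within continuous_within_subset subset_UNIV)
  have bot: "(?F \<longlongrightarrow> 0) at_bot"
    by (rule tendsto_eventually) (use eventually_le_at_bot[of 0] in \<open>eventually_elim, auto\<close>)
  have top: "(?F \<longlongrightarrow> 1) at_top"
    by (rule tendsto_eventually) (use eventually_ge_at_top[of 1] in \<open>eventually_elim, auto\<close>)
  show "real_distribution (PFD \<gamma>)"
    unfolding PFD_def by (rule real_distribution_interval_measure[OF mono cont bot top])
  show "cdf (PFD \<gamma>) x = ?F x"
    unfolding PFD_def by (subst cdf_interval_measure[OF mono cont bot]) auto
qed

definition stochastic_process ::
    "'a measure \<Rightarrow> 'b measure \<Rightarrow> (nat \<Rightarrow> 'a \<Rightarrow> 'b) \<Rightarrow> bool" where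
  "stochastic_process M N X \<longleftrightarrow> (\<forall>n. X n \<in> measurable M N)"

definition stationary_process ::
    "'a measure \<Rightarrow> 'b measure \<Rightarrow> (nat \<Rightarrow> 'a \<Rightarrow> 'b) \<Rightarrow> bool" where
  "stationary_process M N X \<longleftrightarrow>
     stochastic_process M N X \<and>
     (\<forall>J h. finite J \<longrightarrow>
        distr M (PiM J (\<lambda>_. N)) (\<lambda>\<omega>. \<lambda>j\<in>J. X (j + h) \<omega>) =
        distr M (PiM J (\<lambda>_. N)) (\<lambda>\<omega>. \<lambda>j\<in>J. X j \<omega>))"

definition generated_algebra ::
    "'a measure \<Rightarrow> 'b measure \<Rightarrow> (nat \<Rightarrow> 'a \<Rightarrow> 'b) \<Rightarrow> nat set \<Rightarrow> 'a measure" where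
  "generated_algebra M N X J =
     sigma (space M) {X j -` A \<inter> space M |j A. j \<in> J \<and> A \<in> sets N}"

definition cond_prob_algebra ::
    "'a measure \<Rightarrow> 'a measure \<Rightarrow> 'a set \<Rightarrow> 'a \<Rightarrow> real" where
  "cond_prob_algebra M F E = real_cond_exp M F (indicator E)"

definition markov_process ::
    "'a measure \<Rightarrow> 'b measure \<Rightarrow> (nat \<Rightarrow> 'a \<Rightarrow> 'b) \<Rightarrow> bool" where
  "markov_process M N X \<longleftrightarrow>
     stochastic_process M N X \<and>
     (\<forall>n. \<forall>A\<in>sets N. AE \<omega> in M.
        cond_prob_algebra M (generated_algebra M N X {..n}) (X (Suc n) -` A \<inter> space M) \<omega> =
        cond_prob_algebra M (generated_algebra M N X {n}) (X (Suc n) -` A \<inter> space M) \<omega>)"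

end

theory Submission
  imports Defs
begin

text \<open>A recursion \<open>X (n + 1) = f (X n) (U (n + 1))\<close> driven by i.i.d. noise is a homogeneous Markov
  process: the state at time \<open>n\<close> is a function of the noise up to time \<open>n\<close>, hence independent of the
  later noise, so the conditional law of \<open>X (n + 1)\<close> given the past is a kernel evaluated at \<open>X n\<close>.
  It is stationary once its marginals agree. For the power function recursion they do because
  a \<open>PFD \<gamma>\<close> variable raised to the power \<open>1 / c\<close> is \<open>PFD (\<gamma> * c)\<close>, while the maximum of independent \<open>PFD a\<close> and
  \<open>PFD b\<close> variables is \<open>PFD (a + b)\<close>; here \<open>a = \<alpha> - \<delta>\<close> and \<open>b = \<delta>\<close>.\<close>

section \<open>Iterated step maps and consequences of independence\<close>

primrec iterate :: "('s \<Rightarrow> 't \<Rightarrow> 's) \<Rightarrow> 's \<Rightarrow> (nat \<Rightarrow> 't) \<Rightarrow> nat \<Rightarrow> 's" where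
  "iterate f x u 0 = x"
| "iterate f x u (Suc n) = f (iterate f x u n) (u n)"

lemma iterate_cong: "(\<And>i. i < n \<Longrightarrow> u i = v i) \<Longrightarrow> iterate f x u n = iterate f x v n"
  by (induction n) auto

text \<open>Start and noise both depend on a parameter \<open>p\<close>, so that \<open>p\<close>
  can be a noise history or a pair of a state and later noise. Measurability is asked only of the
  coordinates read in \<open>n\<close> steps, because a finite history has no others.\<close>

lemma measurable_iterate:
  assumes f: "case_prod f \<in> S \<Otimes>\<^sub>M T \<rightarrow>\<^sub>M S"
    and x: "x \<in> P \<rightarrow>\<^sub>M S"
    and u: "\<And>i. i < n \<Longrightarrow> (\<lambda>p. u p i) \<in> P \<rightarrow>\<^sub>M T"
  shows "(\<lambda>p. iterate f (x p) (u p) n) \<in> P \<rightarrow>\<^sub>M S"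
  using u
proof (induction n)
  case (Suc n)
  then have "(\<lambda>p. (iterate f (x p) (u p) n, u p n)) \<in> P \<rightarrow>\<^sub>M S \<Otimes>\<^sub>M T"
    by (intro measurable_Pair) auto
  from measurable_compose[OF this f] show ?case
    by simp
qed (use x in simp)

text \<open>The library's \<^const>\<open>prob_space.indep_var\<close> relates variables with values in one and the same
  type; independence of a state and a noise sequence is therefore expressed by the factorization
  of their joint law.\<close>

lemma (in prob_space) distr_Pair_indep_compose:
  assumes indep: "indep_var P V Q W"
    and [measurable]: "a \<in> P \<rightarrow>\<^sub>M S" "b \<in> Q \<rightarrow>\<^sub>M T"
  shows "distr M (S \<Otimes>\<^sub>M T) (\<lambda>\<omega>. (a (V \<omega>), b (W \<omega>))) =
    distr M S (\<lambda>\<omega>. a (V \<omega>)) \<Otimes>\<^sub>M distr M T (\<lambda>\<omega>. b (W \<omega>))"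
proof -
  have [measurable]: "V \<in> M \<rightarrow>\<^sub>M P" "W \<in> M \<rightarrow>\<^sub>M Q"
    using indep by (auto dest: indep_var_rv1 indep_var_rv2)
  have "distr M S (\<lambda>\<omega>. a (V \<omega>)) \<Otimes>\<^sub>M distr M T (\<lambda>\<omega>. b (W \<omega>)) =
      distr (distr M P V) S a \<Otimes>\<^sub>M distr (distr M Q W) T b"
    by (simp add: distr_distr comp_def)
  also have "\<dots> = distr (distr M P V \<Otimes>\<^sub>M distr M Q W) (S \<Otimes>\<^sub>M T) (\<lambda>(x, y). (a x, b y))"
  proof (rule pair_measure_distr)
    have "prob_space (distr (distr M Q W) T b)"
      by (intro prob_space.prob_space_distr prob_space_distr) measurable
    then show "sigma_finite_measure (distr (distr M Q W) T b)"
      by (simp add: prob_space_imp_sigma_finite)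
  qed measurable
  also have "distr M P V \<Otimes>\<^sub>M distr M Q W = distr M (P \<Otimes>\<^sub>M Q) (\<lambda>\<omega>. (V \<omega>, W \<omega>))"
    using indep by (simp add: indep_var_distribution_eq)
  also have "distr \<dots> (S \<Otimes>\<^sub>M T) (\<lambda>(x, y). (a x, b y)) =
      distr M (S \<Otimes>\<^sub>M T) (\<lambda>\<omega>. (a (V \<omega>), b (W \<omega>)))"
    by (simp add: distr_distr comp_def)
  finally show ?thesis ..
qed

text \<open>Freezing: given the information in \<open>V\<close>, the variable \<open>W\<close> keeps
  its law, so the conditional probability is the measure of the section of \<open>E\<close> at
  \<open>Y (V \<omega>)\<close>. The sigma-algebra \<open>F\<close> may be smaller than the one
  generated by \<open>V\<close>, as long as \<open>Y (V \<omega>)\<close> remains measurable for it;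
  this covers the whole past and the present alone in one statement.\<close>

lemma (in prob_space) real_cond_exp_indicator_indep:
  assumes [measurable]: "V \<in> M \<rightarrow>\<^sub>M P" "W \<in> M \<rightarrow>\<^sub>M T"
    and joint: "distr M (P \<Otimes>\<^sub>M T) (\<lambda>\<omega>. (V \<omega>, W \<omega>)) = distr M P V \<Otimes>\<^sub>M distr M T W"
    and F: "subalgebra M F" "sets F \<subseteq> sets (vimage_algebra (space M) V P)"
    and Y: "Y \<in> P \<rightarrow>\<^sub>M S" "(\<lambda>\<omega>. Y (V \<omega>)) \<in> F \<rightarrow>\<^sub>M S"
    and E: "E \<in> sets (S \<Otimes>\<^sub>M T)"
  shows "AE \<omega> in M. real_cond_exp M F (indicator {\<omega> \<in> space M. (Y (V \<omega>), W \<omega>) \<in> E}) \<omega> =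
    measure (distr M T W) (Pair (Y (V \<omega>)) -` E)"
proof -
  note [measurable] = Y E
  interpret F: finite_measure_subalgebra M F
    by unfold_locales (rule F)
  interpret W: prob_space "distr M T W"
    by (rule prob_space_distr) simp
  interpret V: prob_space "distr M P V"
    by (rule prob_space_distr) simp
  let ?k = "\<lambda>y. measure (distr M T W) (Pair y -` E)"
  have E': "E \<in> sets (S \<Otimes>\<^sub>M distr M T W)"
    using E by (simp cong: sets_pair_measure_cong)
  have ek: "(\<lambda>y. emeasure (distr M T W) (Pair y -` E)) \<in> borel_measurable S"
    by (rule W.measurable_emeasure_Pair[OF E'])
  then have k[measurable]: "?k \<in> borel_measurable S"
    unfolding measure_def by simp
  have kF: "(\<lambda>\<omega>. ?k (Y (V \<omega>))) \<in> borel_measurable F"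
    by (rule measurable_compose[OF Y(2) k])
  have "(\<lambda>\<omega>. (Y (V \<omega>), W \<omega>)) \<in> M \<rightarrow>\<^sub>M S \<Otimes>\<^sub>M T"
    by measurable
  then have H: "{\<omega> \<in> space M. (Y (V \<omega>), W \<omega>) \<in> E} \<in> sets M" (is "?H \<in> _")
    by (rule measurable_sets_Collect) (simp add: pred_def E)
  have kint: "integrable M (\<lambda>\<omega>. ?k (Y (V \<omega>)))"
    by (rule integrable_const_bound[where B = 1]) auto
  show ?thesis
  proof (rule F.real_cond_exp_charact[OF _ _ kint kF])
    show "integrable M (indicator ?H :: 'a \<Rightarrow> real)"
      using H by (simp add: emeasure_finite less_top[symmetric])
    fix A assume "A \<in> sets F"
    \<comment> \<open>Every set of \<open>F\<close> is a condition on \<open>V\<close>. Its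
      intersection with the event is therefore a set \<open>?D\<close> in the product space, whose
      measure Fubini computes by sections.\<close>
    then obtain C where C[measurable]: "C \<in> sets P" and A: "A = V -` C \<inter> space M"
      using F(2) measurable_space[of V M P] by (subst (asm) sets_vimage_algebra2) auto
    have [measurable]: "A \<in> sets M"
      unfolding A by measurable
    let ?D = "{p \<in> space (P \<Otimes>\<^sub>M T). fst p \<in> C \<and> (Y (fst p), snd p) \<in> E}"
    have D: "?D \<in> sets (P \<Otimes>\<^sub>M T)"
      by measurable
    have "emeasure M (?H \<inter> A) = emeasure (distr M (P \<Otimes>\<^sub>M T) (\<lambda>\<omega>. (V \<omega>, W \<omega>))) ?D"
      using D by (subst emeasure_distr)
        (auto simp: A space_pair_measure measurable_space[of V M P] measurable_space[of W M T]
          intro!: arg_cong[where f = "emeasure M"])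
    also have "\<dots> = emeasure (distr M P V \<Otimes>\<^sub>M distr M T W) ?D"
      by (simp only: joint)
    also have "\<dots> = (\<integral>\<^sup>+v. emeasure (distr M T W) (Pair v -` ?D) \<partial>distr M P V)"
      using D by (intro W.emeasure_pair_measure_alt) (simp cong: sets_pair_measure_cong)
    also have "\<dots> = (\<integral>\<^sup>+v. ennreal (?k (Y v)) * indicator C v \<partial>distr M P V)"
    proof (rule nn_integral_cong)
      fix v assume v: "v \<in> space (distr M P V)"
      have "Pair (Y v) -` E \<subseteq> space T"
        using sets.sets_into_space[OF E] by (auto simp: space_pair_measure)
      then have "Pair v -` ?D = (if v \<in> C then Pair (Y v) -` E else {})"
        using v by (auto simp: space_pair_measure)
      then show "emeasure (distr M T W) (Pair v -` ?D) = ennreal (?k (Y v)) * indicator C v"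
        by (simp add: W.emeasure_eq_measure)
    qed
    also have "\<dots> = (\<integral>\<^sup>+\<omega>. ennreal (?k (Y (V \<omega>))) * indicator C (V \<omega>) \<partial>M)"
      by (rule nn_integral_distr) measurable
    also have "\<dots> = (\<integral>\<^sup>+\<omega>. ennreal (indicator A \<omega> * ?k (Y (V \<omega>))) \<partial>M)"
      by (rule nn_integral_cong) (auto simp: A indicator_def)
    also have "\<dots> = ennreal (\<integral>\<omega>. indicator A \<omega> * ?k (Y (V \<omega>)) \<partial>M)"
      by (rule nn_integral_eq_integral)
        (auto intro!: integrable_const_bound[where B = 1] simp: indicator_def)
    finally have "measure M (?H \<inter> A) = (\<integral>\<omega>. indicator A \<omega> * ?k (Y (V \<omega>)) \<partial>M)"
      by (simp add: emeasure_eq_measure)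
    moreover have "(\<integral>\<omega>. indicator A \<omega> * indicator ?H \<omega> \<partial>M) = measure M (?H \<inter> A)"
      using H by (subst indicator_inter_arith[symmetric])
        (simp add: Int_commute Int_absorb2 sets.sets_into_space)
    ultimately show "set_lebesgue_integral M A (indicator ?H) =
        set_lebesgue_integral M A (\<lambda>\<omega>. ?k (Y (V \<omega>)))"
      by (simp add: set_lebesgue_integral_def)
  qed
qed

section \<open>Recursions driven by independent noise: joint laws and stationarity\<close>

locale random_recursion = prob_space +
  fixes S :: "'s measure" and T :: "'t measure"
    and f :: "'s \<Rightarrow> 't \<Rightarrow> 's" and g :: "'t \<Rightarrow> 's"
    and U :: "nat \<Rightarrow> 'a \<Rightarrow> 't" and X :: "nat \<Rightarrow> 'a \<Rightarrow> 's"
  assumes f: "case_prod f \<in> S \<Otimes>\<^sub>M T \<rightarrow>\<^sub>M S"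
    and g: "g \<in> T \<rightarrow>\<^sub>M S"
    and indep: "indep_vars (\<lambda>_. T) U UNIV"
    and X_0: "\<omega> \<in> space M \<Longrightarrow> X 0 \<omega> = g (U 0 \<omega>)"
    and X_Suc: "\<omega> \<in> space M \<Longrightarrow> X (Suc n) \<omega> = f (X n \<omega>) (U (Suc n) \<omega>)"
begin

lemma measurable_U [measurable]: "U n \<in> M \<rightarrow>\<^sub>M T"
  using indep by (simp add: indep_vars_def)

text \<open>Restarting at time \<open>h\<close> applies the same iteration to shifted noise. With
  \<open>h = 0\<close> this writes the process in terms of the noise; arbitrary \<open>h\<close>
  serves stationarity.\<close>

lemma X_add:
  "\<omega> \<in> space M \<Longrightarrow> X (h + k) \<omega> = iterate f (X h \<omega>) (\<lambda>i. U (Suc (h + i)) \<omega>) k"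
  by (induction k) (auto simp: X_Suc)

text \<open>Coordinate 0 feeds the initial value and coordinate \<open>Suc i\<close> drives step
  \<open>i\<close>, so exactly the coordinates up to \<open>n\<close> are read.\<close>

definition state :: "nat \<Rightarrow> (nat \<Rightarrow> 't) \<Rightarrow> 's" where
  "state n u = iterate f (g (u 0)) (\<lambda>i. u (Suc i)) n"

text \<open>Restricting the noise to \<open>{..n}\<close> alters only coordinates that the first
  \<open>m\<close> steps never read. Keeping \<open>m\<close> and \<open>n\<close> separate makes
  all states up to time \<open>n\<close> functions of one common history.\<close>

lemma X_eq_state:
  assumes "\<omega> \<in> space M" "m \<le> n"
  shows "X m \<omega> = state m (\<lambda>i\<in>{..n}. U i \<omega>)"
  using assms X_add[of \<omega> 0 m] by (auto simp: state_def X_0 intro!: iterate_cong)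

lemma measurable_state: "m \<le> n \<Longrightarrow> state m \<in> PiM {..n} (\<lambda>_. T) \<rightarrow>\<^sub>M S"
  unfolding state_def
  by (intro measurable_iterate[OF f] measurable_compose[OF _ g] measurable_component_singleton) auto

lemma measurable_history: "(\<lambda>\<omega>. \<lambda>i\<in>{..n}. U i \<omega>) \<in> M \<rightarrow>\<^sub>M PiM {..n} (\<lambda>_. T)"
  by (intro measurable_restrict) simp

lemma measurable_X [measurable]: "X n \<in> M \<rightarrow>\<^sub>M S"
proof -
  have "(\<lambda>\<omega>. state n (\<lambda>i\<in>{..n}. U i \<omega>)) \<in> M \<rightarrow>\<^sub>M S"
    by (rule measurable_compose[OF measurable_history measurable_state]) simp
  then show ?thesis
    by (subst measurable_cong[OF X_eq_state[OF _ order_refl]])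
qed

lemma indep_history_future:
  "indep_var (PiM {..n} (\<lambda>_. T)) (\<lambda>\<omega>. \<lambda>i\<in>{..n}. U i \<omega>)
    (PiM {n<..} (\<lambda>_. T)) (\<lambda>\<omega>. \<lambda>i\<in>{n<..}. U i \<omega>)"
  by (rule indep_var_restrict[OF indep]) auto

text \<open>Reindexing moves the noise after time \<open>n\<close> to the index set
  \<open>UNIV\<close>, so that the laws of futures starting at different times live on one
  space.\<close>

lemma measurable_shift:
  "(\<lambda>u i. u (Suc (n + i))) \<in> PiM {n<..} (\<lambda>_. T) \<rightarrow>\<^sub>M PiM UNIV (\<lambda>_. T)"
proof (rule measurable_PiM_single')
  show "(\<lambda>u. u (Suc (n + i))) \<in> PiM {n<..} (\<lambda>_. T) \<rightarrow>\<^sub>M T" for i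
    by (rule measurable_component_singleton) simp
  show "(\<lambda>u i. u (Suc (n + i))) \<in> space (PiM {n<..} (\<lambda>_. T)) \<rightarrow> (\<Pi>\<^sub>E i\<in>UNIV. space T)"
    by (simp add: space_PiM PiE_iff Pi_iff)
qed

lemma measurable_future [measurable]:
  "(\<lambda>\<omega> i. U (Suc (n + i)) \<omega>) \<in> M \<rightarrow>\<^sub>M PiM UNIV (\<lambda>_. T)"
  by (rule measurable_PiM_single') (auto simp: Pi_iff PiE_iff measurable_space[OF measurable_U])

text \<open>Projecting the future to its first coordinate gives the factorization that
  \<open>real_cond_exp_indicator_indep\<close> takes as \<open>joint\<close>, with the history in
  the role of \<open>V\<close>.\<close>

lemma distr_history_next:
  "distr M (PiM {..n} (\<lambda>_. T) \<Otimes>\<^sub>M T) (\<lambda>\<omega>. (\<lambda>i\<in>{..n}. U i \<omega>, U (Suc n) \<omega>)) =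
    distr M (PiM {..n} (\<lambda>_. T)) (\<lambda>\<omega>. \<lambda>i\<in>{..n}. U i \<omega>) \<Otimes>\<^sub>M distr M T (U (Suc n))"
  using distr_Pair_indep_compose[OF indep_history_future measurable_ident
      measurable_component_singleton[where i = "Suc n"], of n]
  by simp

lemma distr_X_future:
  "distr M (S \<Otimes>\<^sub>M PiM UNIV (\<lambda>_. T)) (\<lambda>\<omega>. (X n \<omega>, \<lambda>i. U (Suc (n + i)) \<omega>)) =
    distr M S (X n) \<Otimes>\<^sub>M distr M (PiM UNIV (\<lambda>_. T)) (\<lambda>\<omega> i. U (Suc (n + i)) \<omega>)"
  using distr_Pair_indep_compose[OF indep_history_future measurable_state[OF order_refl] measurable_shift, of n]
  by (simp add: X_eq_state[OF _ order_refl] cong: distr_cong)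

lemma distr_X_next:
  assumes "b \<in> T \<rightarrow>\<^sub>M N"
  shows "distr M (S \<Otimes>\<^sub>M N) (\<lambda>\<omega>. (X n \<omega>, b (U (Suc n) \<omega>))) =
    distr M S (X n) \<Otimes>\<^sub>M distr M N (\<lambda>\<omega>. b (U (Suc n) \<omega>))"
proof -
  have "(\<lambda>u. b (u (Suc n))) \<in> PiM {n<..} (\<lambda>_. T) \<rightarrow>\<^sub>M N"
    by (rule measurable_compose[OF _ assms]) simp
  from distr_Pair_indep_compose[OF indep_history_future measurable_state[OF order_refl] this]
  show ?thesis
    by (simp add: X_eq_state[OF _ order_refl] cong: distr_cong)
qed

text \<open>Independence and the common law make the whole noise sequence distributed as a power of
  \<open>\<nu>\<close>, and the injective reindexing \<open>i \<mapsto> Suc (n + i)\<close>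
  preserves such a product.\<close>

lemma distr_future:
  assumes "\<And>n. distr M T (U n) = \<nu>"
  shows "distr M (PiM UNIV (\<lambda>_. T)) (\<lambda>\<omega> i. U (Suc (n + i)) \<omega>) = PiM UNIV (\<lambda>_. \<nu>)"
proof -
  have [simp]: "sets \<nu> = sets T"
    using assms[of 0] by auto
  have "distr M (PiM UNIV (\<lambda>_. T)) (\<lambda>\<omega> i. U i \<omega>) = PiM UNIV (\<lambda>_. \<nu>)"
    using indep_vars_iff_distr_eq_PiM[where I = UNIV and M' = "\<lambda>_. T" and X = U] indep assms
    by (simp add: restrict_def)
  moreover have "prob_space \<nu>"
    using prob_space_distr[OF measurable_U, of 0] assms by simp
  then have "distr (PiM UNIV (\<lambda>_. \<nu>)) (PiM UNIV (\<lambda>_. \<nu>)) (\<lambda>u. \<lambda>i\<in>UNIV. u (Suc (n + i)))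
      = PiM UNIV (\<lambda>_. \<nu>)"
    by (intro distr_PiM_reindex) (auto simp: inj_on_def)
  moreover have "distr (distr M (PiM UNIV (\<lambda>_. T)) (\<lambda>\<omega> i. U i \<omega>)) (PiM UNIV (\<lambda>_. \<nu>))
      (\<lambda>u. \<lambda>i\<in>UNIV. u (Suc (n + i))) =
      distr M (PiM UNIV (\<lambda>_. \<nu>)) (\<lambda>\<omega> i. U (Suc (n + i)) \<omega>)"
  proof (subst distr_distr)
    show "(\<lambda>\<omega> i. U i \<omega>) \<in> M \<rightarrow>\<^sub>M PiM UNIV (\<lambda>_. T)"
      by (rule measurable_PiM_single') (auto simp: Pi_iff PiE_iff measurable_space[OF measurable_U])
    have "(\<lambda>u. \<lambda>i\<in>UNIV. u (Suc (n + i))) \<in> PiM UNIV (\<lambda>_. T) \<rightarrow>\<^sub>M PiM UNIV (\<lambda>_. T)"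
      by (intro measurable_restrict measurable_component_singleton) simp
    then show "(\<lambda>u. \<lambda>i\<in>UNIV. u (Suc (n + i))) \<in> PiM UNIV (\<lambda>_. T) \<rightarrow>\<^sub>M PiM UNIV (\<lambda>_. \<nu>)"
      by (simp cong: measurable_cong_sets sets_PiM_cong)
  qed (simp add: comp_def restrict_def)
  ultimately show ?thesis
    by (simp cong: distr_cong sets_PiM_cong)
qed

text \<open>By homogeneity, the process started at time \<open>h\<close> is a fixed measurable function of the pair
  formed by \<open>X h\<close> and the subsequent noise, whose law does not depend on \<open>h\<close>.\<close>

theorem stationary:
  assumes ident: "\<And>n. distr M T (U n) = \<nu>"
    and inv: "\<And>n. distr M S (X n) = \<mu>"
  shows "stationary_process M S X"
proof -
  let ?Q = "PiM UNIV (\<lambda>_. T) :: (nat \<Rightarrow> 't) measure"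
  let ?G = "\<lambda>J p. \<lambda>j\<in>J. iterate f (fst p) (snd p) j"
  have [measurable]: "?G J \<in> S \<Otimes>\<^sub>M ?Q \<rightarrow>\<^sub>M PiM J (\<lambda>_. S)" for J
    by (intro measurable_restrict measurable_iterate[OF f]) measurable
  have "distr M (PiM J (\<lambda>_. S)) (\<lambda>\<omega>. \<lambda>j\<in>J. X (j + h) \<omega>) =
      distr (\<mu> \<Otimes>\<^sub>M PiM UNIV (\<lambda>_. \<nu>)) (PiM J (\<lambda>_. S)) (?G J)" for J h
  proof -
    let ?Z = "\<lambda>\<omega>. (X h \<omega>, \<lambda>i. U (Suc (h + i)) \<omega>)"
    have "distr M (PiM J (\<lambda>_. S)) (\<lambda>\<omega>. \<lambda>j\<in>J. X (j + h) \<omega>) =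
        distr M (PiM J (\<lambda>_. S)) (?G J \<circ> ?Z)"
      by (intro distr_cong) (auto simp: X_add[of _ h] add.commute[of _ h])
    also have "\<dots> = distr (distr M (S \<Otimes>\<^sub>M ?Q) ?Z) (PiM J (\<lambda>_. S)) (?G J)"
      by (subst distr_distr) auto
    also have "distr M (S \<Otimes>\<^sub>M ?Q) ?Z = \<mu> \<Otimes>\<^sub>M PiM UNIV (\<lambda>_. \<nu>)"
      by (simp add: distr_X_future distr_future[OF ident] inv)
    finally show ?thesis .
  qed
  \<comment> \<open>The law just computed does not mention \<open>h\<close>, so its instance at 0
    agrees with every other.\<close>
  from this[of _ 0] this show ?thesis
    by (simp add: stationary_process_def stochastic_process_def)
qed

section \<open>The Markov property\<close>

lemma sets_generated_algebra:
  "sets (generated_algebra M S X J) = sigma_sets (space M) {X j -` A \<inter> space M |j A. j \<in> J \<and> A \<in> sets S}"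
  unfolding generated_algebra_def by (rule sets_measure_of) auto

lemma space_generated_algebra [simp]: "space (generated_algebra M S X J) = space M"
  unfolding generated_algebra_def by (rule space_measure_of) auto

text \<open>States up to time \<open>n\<close> are functions of the noise up to time
  \<open>n\<close>. The inclusion can be strict, since the recursion may forget noise.\<close>

lemma generated_algebra_le:
  assumes "J \<subseteq> {..n}"
  shows "sets (generated_algebra M S X J) \<subseteq>
    sets (vimage_algebra (space M) (\<lambda>\<omega>. \<lambda>i\<in>{..n}. U i \<omega>) (PiM {..n} (\<lambda>_. T)))"
    (is "_ \<subseteq> sets ?V")
proof -
  have hist: "(\<lambda>\<omega>. \<lambda>i\<in>{..n}. U i \<omega>) \<in> ?V \<rightarrow>\<^sub>M PiM {..n} (\<lambda>_. T)"
    using measurable_space[OF measurable_history] by (intro measurable_vimage_algebra1) auto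
  have "X j -` A \<inter> space M \<in> sets ?V" if "j \<in> J" "A \<in> sets S" for j A
  proof -
    have "j \<le> n" using assms that by auto
    then have "(\<lambda>\<omega>. state j (\<lambda>i\<in>{..n}. U i \<omega>)) \<in> ?V \<rightarrow>\<^sub>M S"
      by (intro measurable_compose[OF hist] measurable_state)
    then have "X j \<in> ?V \<rightarrow>\<^sub>M S"
      using \<open>j \<le> n\<close> by (subst measurable_cong[OF X_eq_state]) auto
    from measurable_sets[OF this that(2)] show ?thesis
      by simp
  qed
  then have "{X j -` A \<inter> space M |j A. j \<in> J \<and> A \<in> sets S} \<subseteq> sets ?V"
    by auto
  from sets.sigma_sets_subset[OF this] show ?thesis
    by (simp add: sets_generated_algebra)
qed

text \<open>The right-hand side does not depend on \<open>J\<close>; comparing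
  \<open>J = {..n}\<close> with \<open>J = {n}\<close> is the Markov property. The condition
  \<open>n \<in> J\<close> makes \<open>X n\<close> measurable for the conditioning algebra, and
  \<open>J \<subseteq> {..n}\<close> keeps that algebra inside the history, which is independent of
  \<open>U (Suc n)\<close>.\<close>

lemma AE_cond_prob_next:
  assumes "n \<in> J" "J \<subseteq> {..n}" and A: "A \<in> sets S"
  shows "AE \<omega> in M. cond_prob_algebra M (generated_algebra M S X J) (X (Suc n) -` A \<inter> space M) \<omega> =
    measure (distr M T (U (Suc n))) {t \<in> space T. f (X n \<omega>) t \<in> A}"
proof -
  let ?F = "generated_algebra M S X J"
  let ?V = "\<lambda>\<omega>. \<lambda>i\<in>{..n}. U i \<omega>"
  let ?E = "case_prod f -` A \<inter> space (S \<Otimes>\<^sub>M T)"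
  have sub: "sets ?F \<subseteq> sets (vimage_algebra (space M) ?V (PiM {..n} (\<lambda>_. T)))"
    by (rule generated_algebra_le[OF assms(2)])
  have "sets (vimage_algebra (space M) ?V (PiM {..n} (\<lambda>_. T))) \<subseteq> sets M"
    by (rule sets_image_in_sets[OF refl measurable_history])
  with sub have F: "subalgebra M ?F"
    by (auto simp: subalgebra_def)
  have "X n \<in> ?F \<rightarrow>\<^sub>M S"
    using measurable_space[OF measurable_X[of n]] assms(1)
    by (intro measurableI) (auto simp: sets_generated_algebra intro!: sigma_sets.Basic)
  then have XF: "(\<lambda>\<omega>. state n (?V \<omega>)) \<in> ?F \<rightarrow>\<^sub>M S"
    by (subst (asm) measurable_cong[OF X_eq_state[OF _ order_refl]]) simp_all
  have E: "?E \<in> sets (S \<Otimes>\<^sub>M T)"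
    using f A by (rule measurable_sets)
  have ev: "{\<omega> \<in> space M. (state n (?V \<omega>), U (Suc n) \<omega>) \<in> ?E} = X (Suc n) -` A \<inter> space M"
    using measurable_space[OF measurable_X[of n]] measurable_space[OF measurable_U[of "Suc n"]]
    by (auto simp: X_eq_state[OF _ order_refl, symmetric] X_Suc space_pair_measure)
  have "AE \<omega> in M. real_cond_exp M ?F (indicator (X (Suc n) -` A \<inter> space M)) \<omega> =
      measure (distr M T (U (Suc n))) (Pair (state n (?V \<omega>)) -` ?E)"
    using real_cond_exp_indicator_indep[where V = ?V and W = "U (Suc n)" and Y = "state n",
        OF measurable_history measurable_U distr_history_next F sub measurable_state[OF order_refl] XF E]
    unfolding ev .
  then show ?thesis
  proof (rule AE_mp, intro AE_I2 impI)
    fix \<omega> assume \<omega>: "\<omega> \<in> space M" and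
      eq: "real_cond_exp M ?F (indicator (X (Suc n) -` A \<inter> space M)) \<omega> =
        measure (distr M T (U (Suc n))) (Pair (state n (?V \<omega>)) -` ?E)"
    have "Pair (state n (?V \<omega>)) -` ?E = {t \<in> space T. f (X n \<omega>) t \<in> A}"
      using measurable_space[OF measurable_X[of n] \<omega>]
      by (auto simp: X_eq_state[OF \<omega> order_refl, symmetric] space_pair_measure)
    with eq show "cond_prob_algebra M ?F (X (Suc n) -` A \<inter> space M) \<omega> =
        measure (distr M T (U (Suc n))) {t \<in> space T. f (X n \<omega>) t \<in> A}"
      by (simp add: cond_prob_algebra_def)
  qed
qed

theorem markov: "markov_process M S X"
  unfolding markov_process_def stochastic_process_def
proof (intro conjI allI ballI)
  fix n A assume A: "A \<in> sets S"
  show "AE \<omega> in M. cond_prob_algebra M (generated_algebra M S X {..n}) (X (Suc n) -` A \<inter> space M) \<omega> =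
      cond_prob_algebra M (generated_algebra M S X {n}) (X (Suc n) -` A \<inter> space M) \<omega>"
    using AE_cond_prob_next[of n "{..n}", OF _ _ A, simplified]
      AE_cond_prob_next[of n "{n}", OF _ _ A, simplified]
    by eventually_elim simp
qed simp

end

section \<open>Calculus of power function distributions\<close>

lemma uniform_measure_eq_PFD: "uniform_measure lborel {0<..<1} = PFD 1"
proof (rule cdf_unique)
  have "prob_space (uniform_measure lborel {0<..<1::real})"
    by (rule prob_space_uniform_measure) auto
  then show "real_distribution (uniform_measure lborel {0<..<1})"
    by (simp add: real_distribution_def real_distribution_axioms_def)
  show "real_distribution (PFD 1)"
    by (rule real_distribution_PFD) simp
  show "cdf (uniform_measure lborel {0<..<1}) = cdf (PFD 1)"
  proof
    fix x :: real
    have "measure lborel ({0<..<1} \<inter> {..x}) = max 0 (min 1 x)"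
    proof -
      consider "x \<le> 0" | "0 < x" "x < 1" | "1 \<le> x" by linarith
      then show ?thesis
      proof cases
        case 1
        then have "{0<..<1} \<inter> {..x} = {}" by auto
        with 1 show ?thesis by simp
      next
        case 2
        then have "{0<..<1} \<inter> {..x} = {0<..x}" by auto
        with 2 show ?thesis by simp
      next
        case 3
        then have "{0<..<1} \<inter> {..x} = {0<..<1}" by auto
        with 3 show ?thesis by simp
      qed
    qed
    then show "cdf (uniform_measure lborel {0<..<1}) x = cdf (PFD 1) x"
      by (simp add: cdf_def2 cdf_PFD[unfolded cdf_def2] measure_uniform_measure)
  qed
qed

text \<open>On this range \<open>powr\<close> is the usual power and can be inverted by
  monotonicity; the upper bound also lets thresholds be clamped at 1.\<close>

lemma AE_PFD:
  assumes "\<gamma> > 0"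
  shows "AE x in PFD \<gamma>. 0 < x \<and> x \<le> 1"
proof -
  interpret real_distribution "PFD \<gamma>"
    by (rule real_distribution_PFD[OF assms])
  have "prob {..0} = 0" "prob {..1} = 1"
    using cdf_PFD[OF assms] assms by (simp_all add: cdf_def)
  then have "AE x in PFD \<gamma>. x \<notin> {..0}" "AE x in PFD \<gamma>. x \<in> {..1}"
    by (simp_all add: prob_eq_0 prob_eq_1)
  then show ?thesis
    by eventually_elim auto
qed

lemma powr_le_iff_le_powr:
  fixes x y c :: real
  assumes "0 \<le> y" "0 \<le> x" "0 < c"
  shows "y powr (1 / c) \<le> x \<longleftrightarrow> y \<le> x powr c"
proof
  assume "y powr (1 / c) \<le> x"
  then have "(y powr (1 / c)) powr c \<le> x powr c"
    using assms by (intro powr_mono2) auto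
  then show "y \<le> x powr c"
    using assms by (simp add: powr_powr)
next
  assume "y \<le> x powr c"
  then have "y powr (1 / c) \<le> (x powr c) powr (1 / c)"
    using assms by (intro powr_mono2) auto
  then show "y powr (1 / c) \<le> x"
    using assms by (simp add: powr_powr)
qed

text \<open>For \<open>x\<close> in the unit interval, \<open>y powr (1 / c) \<le> x\<close> means
  \<open>y \<le> x powr c\<close>, which has probability
  \<open>(x powr c) powr \<gamma>\<close>.\<close>

lemma distr_PFD_powr:
  assumes "\<gamma> > 0" "c > 0"
  shows "distr (PFD \<gamma>) borel (\<lambda>y. y powr (1 / c)) = PFD (\<gamma> * c)" (is "?L = _")
proof (rule cdf_unique)
  interpret real_distribution "PFD \<gamma>"
    by (rule real_distribution_PFD) fact
  have meas: "(\<lambda>y. y powr (1 / c)) \<in> borel_measurable (PFD \<gamma>)"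
    by measurable
  then show "real_distribution ?L"
    by (intro real_distribution_distr)
  show "real_distribution (PFD (\<gamma> * c))"
    using assms by (intro real_distribution_PFD) simp
  show "cdf ?L = cdf (PFD (\<gamma> * c))"
  proof
    fix x :: real
    have L: "cdf ?L x = prob {y. y powr (1 / c) \<le> x}"
      unfolding cdf_def using meas by (subst measure_distr) (auto simp: vimage_def)
    show "cdf ?L x = cdf (PFD (\<gamma> * c)) x"
    proof (cases "x < 0")
      case True
      then have "{y. y powr (1 / c) \<le> x} = {}"
        using powr_ge_zero order.strict_trans1 by fastforce
      with True assms show ?thesis
        unfolding L by (simp add: cdf_PFD)
    next
      case False
      \<comment> \<open>Almost surely the power is at most 1, so \<open>x\<close> may be replaced by
        \<open>min 1 x\<close>, which also covers thresholds above 1.\<close>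
      have "prob {y. y powr (1 / c) \<le> x} = prob {..min 1 x powr c}"
      proof (rule finite_measure_eq_AE)
        show "AE y in PFD \<gamma>. y \<in> {y. y powr (1 / c) \<le> x} \<longleftrightarrow> y \<in> {..min 1 x powr c}"
          using AE_PFD[OF assms(1)]
        proof eventually_elim
          fix y :: real assume y: "0 < y \<and> y \<le> 1"
          then have "y powr (1 / c) \<le> 1"
            using assms by (simp add: powr_le1)
          then have "y powr (1 / c) \<le> x \<longleftrightarrow> y powr (1 / c) \<le> min 1 x"
            by auto
          moreover have "0 \<le> min 1 x"
            using False by simp
          ultimately show "y \<in> {y. y powr (1 / c) \<le> x} \<longleftrightarrow> y \<in> {..min 1 x powr c}"
            using y assms powr_le_iff_le_powr[of y "min 1 x" c] by simp
        qed
      qed measurable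
      also have "\<dots> = max 0 (min 1 (min 1 x powr c)) powr \<gamma>"
        using cdf_PFD[OF assms(1)] by (simp add: cdf_def)
      also have "min 1 (min 1 x powr c) = min 1 x powr c"
        using False assms by (intro min_absorb2 powr_le1) auto
      finally show ?thesis
        using False assms by (simp add: L cdf_PFD powr_powr mult.commute)
    qed
  qed
qed

text \<open>Inverting the power turns the bound on the maximum into one bound on \<open>X\<close>
  and one on \<open>V\<close>. The two bounds on \<open>X\<close> merge into a minimum, the event
  becomes a rectangle, and independence factors its probability.\<close>

lemma (in prob_space) joint_cdf_PFD_step:
  fixes X V :: "'a \<Rightarrow> real"
  assumes indep: "indep_var borel X borel V"
    and X: "distr M borel X = PFD \<alpha>" and V: "distr M borel V = PFD \<delta>"
    and nonneg: "\<And>\<omega>. \<omega> \<in> space M \<Longrightarrow> 0 \<le> X \<omega>"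
    and \<delta>: "0 < \<delta>" "\<delta> < \<alpha>" and x: "x0 \<in> {0..1}" "x1 \<in> {0..1}"
  shows "prob {\<omega> \<in> space M. X \<omega> \<le> x0 \<and> max (X \<omega> powr (\<alpha> / (\<alpha> - \<delta>))) (V \<omega>) \<le> x1} =
    x1 powr \<delta> * min (x0 powr \<alpha>) (x1 powr (\<alpha> - \<delta>))"
proof -
  have [measurable]: "X \<in> borel_measurable M" "V \<in> borel_measurable M"
    using indep by (auto dest: indep_var_rv1 indep_var_rv2)
  \<comment> \<open>Chosen so that \<open>1 / c\<close> is the exponent in the recursion; then
    \<open>(x1 powr c) powr \<alpha>\<close> is
    \<open>x1 powr (\<alpha> - \<delta>)\<close>.\<close>
  define c where "c = (\<alpha> - \<delta>) / \<alpha>"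
  have c: "0 < c" "\<alpha> / (\<alpha> - \<delta>) = 1 / c" "c * \<alpha> = \<alpha> - \<delta>"
    using \<delta> by (auto simp: c_def field_simps)
  let ?m = "min x0 (x1 powr c)"
  have m: "?m \<in> {0..1}"
    using x by (auto simp: min_le_iff_disj)
  have cdf: "prob {\<omega> \<in> space M. Y \<omega> \<le> y} = y powr \<gamma>"
    if "distr M borel Y = PFD \<gamma>" "0 < \<gamma>" "y \<in> {0..1}" "Y \<in> borel_measurable M"
    for Y :: "'a \<Rightarrow> real" and y \<gamma>
  proof -
    have "prob {\<omega> \<in> space M. Y \<omega> \<le> y} = cdf (distr M borel Y) y"
      using that(4) unfolding cdf_def
      by (subst measure_distr) (auto intro!: arg_cong[where f = prob])
    with that show ?thesis
      by (simp add: cdf_PFD)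
  qed
  have "{\<omega> \<in> space M. X \<omega> \<le> x0 \<and> max (X \<omega> powr (\<alpha> / (\<alpha> - \<delta>))) (V \<omega>) \<le> x1} =
      (\<lambda>\<omega>. (X \<omega>, V \<omega>)) -` ({..?m} \<times> {..x1}) \<inter> space M"
    using nonneg x c(1) by (auto simp: c(2) powr_le_iff_le_powr)
  also have "prob \<dots> = measure (distr M (borel \<Otimes>\<^sub>M borel) (\<lambda>\<omega>. (X \<omega>, V \<omega>))) ({..?m} \<times> {..x1})"
    by (subst measure_distr) auto
  also have "\<dots> = measure (distr M borel X \<Otimes>\<^sub>M distr M borel V) ({..?m} \<times> {..x1})"
    using indep by (simp add: indep_var_distribution_eq)
  also have "\<dots> = measure (distr M borel X) {..?m} * measure (distr M borel V) {..x1}"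
  proof -
    interpret V: prob_space "distr M borel V" by (rule prob_space_distr) simp
    show ?thesis
      by (simp add: measure_def V.emeasure_pair_measure_Times enn2real_mult)
  qed
  also have "\<dots> = ?m powr \<alpha> * x1 powr \<delta>"
    using m x \<delta> by (simp add: X V cdf_PFD[unfolded cdf_def])
  also have "?m powr \<alpha> = min (x0 powr \<alpha>) ((x1 powr c) powr \<alpha>)"
    using \<delta> x powr_mono2[of \<alpha> x0 "x1 powr c"] powr_mono2[of \<alpha> "x1 powr c" x0]
    by (auto simp: min_def)
  finally show ?thesis
    by (simp add: powr_powr c(3) mult.commute[of _ "x1 powr \<delta>"])
qed

text \<open>The joint distribution function at \<open>x0 = 1\<close> gives the marginal: \<open>x
  powr \<delta> * x powr (\<alpha> - \<delta>) = x powr \<alpha>\<close>.\<close>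

lemma (in prob_space) distr_PFD_step:
  fixes X V :: "'a \<Rightarrow> real"
  assumes indep: "indep_var borel X borel V"
    and X: "distr M borel X = PFD \<alpha>" and V: "distr M borel V = PFD \<delta>"
    and nonneg: "\<And>\<omega>. \<omega> \<in> space M \<Longrightarrow> 0 \<le> X \<omega>"
    and \<delta>: "0 < \<delta>" "\<delta> < \<alpha>"
  shows "distr M borel (\<lambda>\<omega>. max (X \<omega> powr (\<alpha> / (\<alpha> - \<delta>))) (V \<omega>)) = PFD \<alpha>"
    (is "distr M borel ?Y = _")
proof (rule cdf_unique)
  have [measurable]: "X \<in> borel_measurable M" "V \<in> borel_measurable M"
    using indep by (auto dest: indep_var_rv1 indep_var_rv2)
  have \<alpha>: "0 < \<alpha>"
    using \<delta> by simp
  interpret Y: real_distribution "distr M borel ?Y"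
    by (rule real_distribution_distr) measurable
  show "real_distribution (distr M borel ?Y)"
    by (rule Y.real_distribution_axioms)
  show "real_distribution (PFD \<alpha>)"
    by (rule real_distribution_PFD[OF \<alpha>])
  have cdf_Y: "cdf (distr M borel ?Y) x = prob {\<omega> \<in> space M. ?Y \<omega> \<le> x}" for x
    unfolding cdf_def by (subst measure_distr) (auto intro!: arg_cong[where f = prob])
  have "AE x in distr M borel X. 0 < x \<and> x \<le> 1"
    unfolding X by (rule AE_PFD[OF \<alpha>])
  then have AE_X: "AE \<omega> in M. X \<omega> \<le> 1"
    by (subst (asm) AE_distr_iff) auto
  have unit: "cdf (distr M borel ?Y) x = x powr \<alpha>" if x: "x \<in> {0..1}" for x
  proof -
    \<comment> \<open>The added condition holds almost surely and brings the event into the form of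
      the joint law.\<close>
    have "prob {\<omega> \<in> space M. ?Y \<omega> \<le> x} = prob {\<omega> \<in> space M. X \<omega> \<le> 1 \<and> ?Y \<omega> \<le> x}"
      by (rule finite_measure_eq_AE) (use AE_X in \<open>eventually_elim, auto\<close>, measurable)
    also have "\<dots> = x powr \<delta> * min (1 powr \<alpha>) (x powr (\<alpha> - \<delta>))"
      using x by (intro joint_cdf_PFD_step[OF indep X V nonneg \<delta>]) auto
    also have "\<dots> = x powr \<alpha>"
      using x \<delta> by (simp add: min_absorb2 powr_le1 flip: powr_add)
    finally show ?thesis
      by (simp add: cdf_Y)
  qed
  show "cdf (distr M borel ?Y) = cdf (PFD \<alpha>)"
  proof
    fix x :: real
    consider "x < 0" | "x \<in> {0..1}" | "1 < x" by fastforce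
    then show "cdf (distr M borel ?Y) x = cdf (PFD \<alpha>) x"
    proof cases
      case 1
      then have "{\<omega> \<in> space M. ?Y \<omega> \<le> x} = {}"
        by (auto simp: not_le intro: less_le_trans[OF _ powr_ge_zero])
      with 1 \<alpha> show ?thesis
        unfolding cdf_Y by (simp only: measure_empty) (simp add: cdf_PFD)
    next
      case 2
      with \<alpha> show ?thesis
        by (simp add: unit cdf_PFD)
    next
      case 3
      \<comment> \<open>The value 1 is already reached at 1, and monotonicity carries it to the
        right.\<close>
      then have "1 \<le> cdf (distr M borel ?Y) x"
        using Y.cdf_nondecreasing[of 1 x] unit[of 1] by simp
      with 3 \<alpha> Y.cdf_bounded_prob[of x] show ?thesis
        by (simp add: cdf_PFD)
    qed
  qed
qed

section \<open>The power function recursion\<close>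

theorem theorem4:
  fixes M :: "'a measure"
    and \<alpha> \<delta> :: real
    and U X :: "nat \<Rightarrow> 'a \<Rightarrow> real"
  assumes "prob_space M"
    and "\<alpha> > 0"
    and "0 < \<delta>" and "\<delta> < \<alpha>"
    and "prob_space.indep_vars M (\<lambda>_. borel) U UNIV"
    and "\<And>n. distr M borel (U n) = uniform_measure lborel {0<..<1}"
    and "\<And>\<omega>. \<omega> \<in> space M \<Longrightarrow> X 0 \<omega> = U 0 \<omega> powr (1 / \<alpha>)"
    and "\<And>n \<omega>. n \<ge> 1 \<Longrightarrow> \<omega> \<in> space M \<Longrightarrow>
           X n \<omega> = max (X (n - 1) \<omega> powr (\<alpha> / (\<alpha> - \<delta>))) (U n \<omega> powr (1 / \<delta>))"
  shows "(stationary_process M borel X \<and> markov_process M borel X) \<and>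
    (\<forall>n. distr M borel (X n) = PFD \<alpha>) \<and>
    (\<forall>n\<ge>1. \<forall>x0\<in>{0..1}. \<forall>x1\<in>{0..1}.
       measure M {\<omega> \<in> space M. X (n - 1) \<omega> \<le> x0 \<and> X n \<omega> \<le> x1} =
         x1 powr \<delta> * min (x0 powr \<alpha>) (x1 powr (\<alpha> - \<delta>)))"
proof -
  interpret random_recursion M borel borel
    "\<lambda>x u. max (x powr (\<alpha> / (\<alpha> - \<delta>))) (u powr (1 / \<delta>))" "\<lambda>u. u powr (1 / \<alpha>)" U X
    using assms by (intro random_recursion.intro random_recursion_axioms.intro) auto
  \<comment> \<open>Holds at every sample point, because each \<open>X n\<close> is a power or a
    maximum involving one.\<close>
  have nonneg: "0 \<le> X n \<omega>" if "\<omega> \<in> space M" for n \<omega>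
    using that by (cases n) (auto simp: X_0 X_Suc le_max_iff_disj)
  have powr_U: "distr M borel (\<lambda>\<omega>. U n \<omega> powr (1 / \<gamma>)) = PFD \<gamma>" if "\<gamma> > 0" for n \<gamma>
  proof -
    have "distr (distr M borel (U n)) borel (\<lambda>u. u powr (1 / \<gamma>)) = PFD \<gamma>"
      using distr_PFD_powr[of 1 \<gamma>] that by (simp add: assms(6) uniform_measure_eq_PFD)
    then show ?thesis
      by (subst (asm) distr_distr) (auto simp: comp_def)
  qed
  \<comment> \<open>State and transformed noise are both real here, so the factorized joint law can
    be read as \<open>indep_var\<close>.\<close>
  have indep_V: "indep_var borel (X n) borel (\<lambda>\<omega>. U (Suc n) \<omega> powr (1 / \<delta>))" for n
  proof -
    have "(\<lambda>u::real. u powr (1 / \<delta>)) \<in> borel \<rightarrow>\<^sub>M borel" by measurable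
    from distr_X_next[OF this, of n] show ?thesis
      unfolding indep_var_distribution_eq by simp
  qed
  have law: "distr M borel (X n) = PFD \<alpha>" for n
  proof (induction n)
    case 0
    have "distr M borel (X 0) = distr M borel (\<lambda>\<omega>. U 0 \<omega> powr (1 / \<alpha>))"
      by (intro distr_cong) (auto simp: X_0)
    then show ?case
      using powr_U assms(2) by simp
  next
    case (Suc n)
    have "distr M borel (X (Suc n)) =
        distr M borel (\<lambda>\<omega>. max (X n \<omega> powr (\<alpha> / (\<alpha> - \<delta>))) (U (Suc n) \<omega> powr (1 / \<delta>)))"
      by (intro distr_cong) (auto simp: X_Suc)
    then show ?case
      using distr_PFD_step[OF indep_V Suc powr_U nonneg assms(3,4)] assms(3) by simp
  qed
  have joint: "prob {\<omega> \<in> space M. X (n - 1) \<omega> \<le> x0 \<and> X n \<omega> \<le> x1} =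
      x1 powr \<delta> * min (x0 powr \<alpha>) (x1 powr (\<alpha> - \<delta>))"
    if "1 \<le> n" "x0 \<in> {0..1}" "x1 \<in> {0..1}" for n x0 x1
  proof -
    \<comment> \<open>Since \<open>1 \<le> n\<close>, \<open>Suc (n - 1)\<close> is
      \<open>n\<close>; this matches the indexing of \<open>indep_V\<close>.\<close>
    have "{\<omega> \<in> space M. X (n - 1) \<omega> \<le> x0 \<and> X n \<omega> \<le> x1} = {\<omega> \<in> space M. X (n - 1) \<omega> \<le> x0 \<and>
        max (X (n - 1) \<omega> powr (\<alpha> / (\<alpha> - \<delta>))) (U (Suc (n - 1)) \<omega> powr (1 / \<delta>)) \<le> x1}"
      using that(1) assms(8) by auto
    then show ?thesis
      using joint_cdf_PFD_step[OF indep_V law powr_U nonneg assms(3,4) that(2,3), of "n - 1"]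
        assms(3) by simp
  qed
  show ?thesis
    using stationary[OF assms(6) law] markov law joint by blast
qed

end
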